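(* Let $\mathcal{H}$ and $\mathcal{K}$ be real or complex Hilbert spaces and let $R,S$ be densely defined linear operators from $\mathcal{H}$ to $\mathcal{K}$. The following statements are equivalent: (i) $R+S$ is densely defined and $(R+S)^*=R^*+S^*$. (ii) $G(R+S)^{\perp}=W\langle G(R^*+S^* )\rangle$. (iii) $G(R+S)^{\perp}\subseteq\operatorname{ran}(M_{R+S,\,R^*+S^*})$.
   Context: Linear operators are defined on linear subspaces (not necessarily closed or bounded); sums have their natural domains, $\operatorname{dom}(R+S)=\operatorname{dom}R\cap\operatorname{dom}S$, and equality of operators includes equality of domains. $G(A)=\{(h,Ah): h\in\operatorname{dom}A\}$ is the graph, and $\perp$ is taken in the product Hilbert space $\mathcal{H}\times\mathcal{K}$. $W:\mathcal{K}\times\mathcal{H}\to\mathcal{H}\times\mathcal{K}$ is the flip $W(k,h)=(-h,k)$, and $W\langle\cdot\rangle$ denotes image. For operators $A$ from $\mathcal{H}$ to $\mathcal{K}$ and $B$ from $\mathcal{K}$ to $\mathcal{H}$, $M_{A,B}$ is the operator in $\mathcal{H}\times\mathcal{K}$ with domain $\operatorname{dom}A\times\operatorname{dom}B$ given by $M_{A,B}(h,k)=(h-Bk,\,Ah+k)$. *)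

theory Defs
  imports "HOL-Analysis.Analysis"
begin

text \<open>
  A Hilbert space over \<open>F\<close>, where \<open>F\<close> is \<open>\<real>\<close> or \<open>\<complex>\<close>, both taken as subsets of the type
  \<^typ>\<open>complex\<close>. Norm, topology and completeness are those of the carrier type; \<open>scale_of_real\<close>
  and \<open>Re_ip\<close> say that the scalar multiplication extends \<^const>\<open>scaleR\<close> and that the inner product
  \<open>ip\<close> (linear in the first argument) induces the norm of the type.
  For \<open>F = \<real>\<close> the inner product is forced to be \<^const>\<open>inner\<close>, and \<open>scale\<close> is only relevant
  (and only constrained) on \<open>F\<close>.
\<close>

locale hilbert_space =
  fixes F :: "complex set"
    and scale :: "complex \<Rightarrow> 'h::{real_inner,complete_space} \<Rightarrow> 'h"
    and ip :: "'h \<Rightarrow> 'h \<Rightarrow> complex"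
  assumes scalars: "F = \<real> \<or> F = UNIV"
    and scale_add_right: "a \<in> F \<Longrightarrow> scale a (x + y) = scale a x + scale a y"
    and scale_add_left: "a \<in> F \<Longrightarrow> b \<in> F \<Longrightarrow> scale (a + b) x = scale a x + scale b x"
    and scale_scale: "a \<in> F \<Longrightarrow> b \<in> F \<Longrightarrow> scale a (scale b x) = scale (a * b) x"
    and scale_of_real: "scale (of_real r) x = r *\<^sub>R x"
    and ip_in_scalars: "ip x y \<in> F"
    and ip_add_left: "ip (x + y) z = ip x z + ip y z"
    and ip_scale_left: "a \<in> F \<Longrightarrow> ip (scale a x) y = a * ip x y"
    and ip_commute: "ip y x = cnj (ip x y)"
    and Re_ip: "Re (ip x y) = inner x y"

lemma hilbert_space_real:
  "hilbert_space \<real> (\<lambda>a x :: 'h::{real_inner,complete_space}. Re a *\<^sub>R x) (\<lambda>x y. of_real (inner x y))"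
  by unfold_locales
    (auto simp: scaleR_add_right scaleR_add_left inner_add_left inner_add_right inner_commute elim!: Reals_cases)

lemma hilbert_space_complex: "hilbert_space UNIV (*) (\<lambda>x y :: complex. x * cnj y)"
  by unfold_locales (auto simp: algebra_simps scaleR_conv_of_real inner_complex_def)

definition prod_scale ::
    "(complex \<Rightarrow> 'h \<Rightarrow> 'h) \<Rightarrow> (complex \<Rightarrow> 'k \<Rightarrow> 'k) \<Rightarrow> complex \<Rightarrow> 'h \<times> 'k \<Rightarrow> 'h \<times> 'k"
  where "prod_scale sH sK a p = (sH a (fst p), sK a (snd p))"

definition prod_ip ::
    "('h \<Rightarrow> 'h \<Rightarrow> complex) \<Rightarrow> ('k \<Rightarrow> 'k \<Rightarrow> complex) \<Rightarrow> 'h \<times> 'k \<Rightarrow> 'h \<times> 'k \<Rightarrow> complex"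
  where "prod_ip ipH ipK p q = ipH (fst p) (fst q) + ipK (snd p) (snd q)"

lemma hilbert_space_prod:
  assumes "hilbert_space F sH ipH" and "hilbert_space F sK ipK"
  shows "hilbert_space F (prod_scale sH sK) (prod_ip ipH ipK)"
proof -
  interpret H: hilbert_space F sH ipH by fact
  interpret K: hilbert_space F sK ipK by fact
  show ?thesis
  proof unfold_locales
    show "F = \<real> \<or> F = UNIV" by (rule H.scalars)
    show "prod_ip ipH ipK x y \<in> F" for x y
      using H.scalars H.ip_in_scalars[of "fst x" "fst y"] K.ip_in_scalars[of "snd x" "snd y"]
      by (auto simp: prod_ip_def)
    show "prod_ip ipH ipK y x = cnj (prod_ip ipH ipK x y)" for x y
      using H.ip_commute[of "fst y" "fst x"] K.ip_commute[of "snd y" "snd x"]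
      by (simp add: prod_ip_def)
  qed (simp_all add: prod_scale_def prod_ip_def H.scale_add_right K.scale_add_right
      H.scale_add_left K.scale_add_left H.scale_scale K.scale_scale H.scale_of_real
      K.scale_of_real H.ip_add_left K.ip_add_left H.ip_scale_left K.ip_scale_left
      H.Re_ip K.Re_ip scaleR_prod_def inner_prod_def algebra_simps)
qed

definition orth_compl :: "('h \<Rightarrow> 'h \<Rightarrow> complex) \<Rightarrow> 'h set \<Rightarrow> 'h set"
  where "orth_compl ip V = {x. \<forall>y\<in>V. ip x y = 0}"

text \<open>
  An operator from \<open>'h\<close> to \<open>'k\<close> with a domain is a partial function \<open>'h \<rightharpoonup> 'k\<close>, so that equality
  of operators includes equality of domains; domain, range and graph are \<^const>\<open>dom\<close>,
  \<^const>\<open>ran\<close> and \<^const>\<open>Map.graph\<close>.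
\<close>

definition linear_operator ::
    "complex set \<Rightarrow> (complex \<Rightarrow> 'h \<Rightarrow> 'h) \<Rightarrow> (complex \<Rightarrow> 'k \<Rightarrow> 'k) \<Rightarrow>
     ('h::ab_group_add \<rightharpoonup> 'k::ab_group_add) \<Rightarrow> bool"
  where "linear_operator F sH sK A \<longleftrightarrow>
    0 \<in> dom A \<and>
    (\<forall>x\<in>dom A. \<forall>y\<in>dom A. x + y \<in> dom A \<and> the (A (x + y)) = the (A x) + the (A y)) \<and>
    (\<forall>a\<in>F. \<forall>x\<in>dom A. sH a x \<in> dom A \<and> the (A (sH a x)) = sK a (the (A x)))"

definition densely_defined :: "('h::topological_space \<rightharpoonup> 'k) \<Rightarrow> bool"
  where "densely_defined A \<longleftrightarrow> closure (dom A) = UNIV"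

definition op_sum :: "('h \<rightharpoonup> 'k::plus) \<Rightarrow> ('h \<rightharpoonup> 'k) \<Rightarrow> ('h \<rightharpoonup> 'k)"  (infixl "+\<^sub>o" 65)
  where "A +\<^sub>o B =
    (\<lambda>h. if h \<in> dom A \<inter> dom B then Some (the (A h) + the (B h)) else None)"

text \<open>
  The adjoint of a densely defined operator: \<open>k\<close> is in its domain iff there is \<open>z\<close> with
  \<open>\<langle>A h, k\<rangle> = \<langle>h, z\<rangle>\<close> for all \<open>h \<in> dom A\<close>, and then its value at \<open>k\<close> is \<open>z\<close>. Density
  of \<open>dom A\<close> makes \<open>z\<close> unique; without it the value is unspecified.
\<close>

definition adjoint_op ::
    "('h \<Rightarrow> 'h \<Rightarrow> complex) \<Rightarrow> ('k \<Rightarrow> 'k \<Rightarrow> complex) \<Rightarrow> ('h \<rightharpoonup> 'k) \<Rightarrow> ('k \<rightharpoonup> 'h)"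
  where "adjoint_op ipH ipK A =
    (\<lambda>k. if \<exists>z. \<forall>h\<in>dom A. ipK (the (A h)) k = ipH h z
         then Some (THE z. \<forall>h\<in>dom A. ipK (the (A h)) k = ipH h z)
         else None)"

definition flip :: "'k \<times> 'h \<Rightarrow> 'h::uminus \<times> 'k"
  where "flip = (\<lambda>(k, h). (- h, k))"

definition M_op ::
    "('h \<rightharpoonup> 'k) \<Rightarrow> ('k \<rightharpoonup> 'h) \<Rightarrow> ('h::ab_group_add \<times> 'k::ab_group_add \<rightharpoonup> 'h \<times> 'k)"
  where "M_op A B =
    (\<lambda>(h, k). if h \<in> dom A \<and> k \<in> dom B then Some (h - the (B k), the (A h) + k) else None)"

end

theory Submission
  imports Defs
begin

text \<open>
  Since \<open>(u, k) \<in> G(A)\<^sup>\<bottom>\<close> means \<open>\<langle>A h, k\<rangle> = \<langle>h, -u\<rangle>\<close> for all \<open>h\<close>, the set \<open>G(A)\<^sup>\<bottom>\<close> is the flipped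
  graph of the adjoint whenever \<open>A\<close> is densely defined, and it always contains the flipped graph of
  \<open>R\<^sup>* + S\<^sup>*\<close> for \<open>A = R + S\<close>. Conversely, if the two sets agree then \<open>u \<bottom> dom A\<close> puts \<open>(u, 0)\<close> into a
  flipped graph, which forces \<open>u = 0\<close>; so \<open>dom A\<close> is dense by the projection theorem. Finally, an
  element of \<open>G(A)\<^sup>\<bottom>\<close> of the form \<open>(h - B k, A h + k)\<close> with \<open>B = R\<^sup>* + S\<^sup>*\<close> differs from \<open>(- B k, k)\<close> by
  \<open>(h, A h)\<close>, which therefore lies in \<open>G(A) \<inter> G(A)\<^sup>\<bottom>\<close> and vanishes.
\<close>

section \<open>Nearest points in closed convex sets and a density criterion\<close>

lemma closest_point_exists_convex:
  fixes S :: "'a::{real_inner,complete_space} set"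
  assumes "convex S" and "closed S" and "S \<noteq> {}"
  obtains a where "a \<in> S" and "\<And>y. y \<in> S \<Longrightarrow> dist x a \<le> dist x y"
proof -
  define d where "d = infdist x S"
  have d: "d \<ge> 0" "\<And>y. y \<in> S \<Longrightarrow> d \<le> dist x y"
    by (auto simp: d_def infdist_nonneg infdist_le)
  \<comment> \<open>The sets \<open>T n\<close> of near-minimisers are closed, nonempty and
    decreasing, and by the parallelogram law their diameters tend to 0. Completeness then yields a
    common point, whose distance to \<open>x\<close> is \<open>d\<close>.\<close>
  define T where "T n = {y \<in> S. (dist x y)\<^sup>2 \<le> d\<^sup>2 + 1 / real (Suc n)}" for n
  have mid: "(dist y z)\<^sup>2 \<le> 4 / real (Suc n)" if "y \<in> T n" "z \<in> T n" for y z n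
  proof -
    have S: "(1 / 2) *\<^sub>R y + (1 / 2) *\<^sub>R z \<in> S"
      using that assms(1) by (auto simp: T_def convex_def)
    \<comment> \<open>Parallelogram law for \<open>x - y\<close> and \<open>x - z\<close>. By
      convexity the midpoint lies in \<open>S\<close>, so its distance to \<open>x\<close> is at
      least \<open>d\<close>, and the terms in \<open>d\<close> cancel.\<close>
    have "(dist y z)\<^sup>2 + 4 * (dist x ((1 / 2) *\<^sub>R y + (1 / 2) *\<^sub>R z))\<^sup>2
        = 2 * (dist x y)\<^sup>2 + 2 * (dist x z)\<^sup>2"
      by (simp add: dist_norm power2_norm_eq_inner inner_simps inner_commute field_simps)
    moreover have "d\<^sup>2 \<le> (dist x ((1 / 2) *\<^sub>R y + (1 / 2) *\<^sub>R z))\<^sup>2"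
      using d S by (intro power_mono) auto
    moreover have "(dist x y)\<^sup>2 \<le> d\<^sup>2 + 1 / real (Suc n)" "(dist x z)\<^sup>2 \<le> d\<^sup>2 + 1 / real (Suc n)"
      using that by (auto simp: T_def)
    ultimately show ?thesis by simp
  qed
  obtain a where a: "\<And>n. a \<in> T n"
  proof (rule decreasing_closed_nest)
    show "closed (T n)" for n
    proof -
      have "T n = S \<inter> {y. (dist x y)\<^sup>2 \<le> d\<^sup>2 + 1 / real (Suc n)}" by (auto simp: T_def)
      then show ?thesis
        using assms(2) by (auto intro!: closed_Int closed_Collect_le continuous_intros)
    qed
    show "T n \<noteq> {}" for n
    proof -
      \<comment> \<open>The bound lies strictly above the infimum \<open>d\<close>, so some point of
        \<open>S\<close> comes closer to \<open>x\<close> than it.\<close>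
      have "d < sqrt (d\<^sup>2 + 1 / real (Suc n))" by (intro real_less_rsqrt) auto
      then obtain y where y: "y \<in> S" "dist x y < sqrt (d\<^sup>2 + 1 / real (Suc n))"
        using assms(3) cInf_lessD[of "dist x ` S"] by (auto simp: d_def infdist_notempty)
      have "(dist x y)\<^sup>2 \<le> (sqrt (d\<^sup>2 + 1 / real (Suc n)))\<^sup>2"
        using y by (intro power_mono) auto
      then show ?thesis using y by (auto simp: T_def)
    qed
    show "T n \<subseteq> T m" if "m \<le> n" for m n
    proof -
      have "1 / real (Suc n) \<le> 1 / real (Suc m)" using that by (simp add: frac_le)
      then show ?thesis by (force simp: T_def)
    qed
    show "\<exists>n. \<forall>y\<in>T n. \<forall>z\<in>T n. dist y z < \<epsilon>" if "\<epsilon> > 0" for \<epsilon> :: real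
    proof -
      \<comment> \<open>\<open>n\<close> is chosen so that the bound 4 / (n + 1) on squared
        distances in \<open>T n\<close> falls below the square of \<epsilon>.\<close>
      obtain n where n: "inverse (real (Suc n)) < \<epsilon>\<^sup>2 / 4"
        using reals_Archimedean[of "\<epsilon>\<^sup>2 / 4"] \<open>\<epsilon> > 0\<close>
        by (metis divide_pos_pos zero_less_numeral zero_less_power)
      have "dist y z < \<epsilon>" if "y \<in> T n" "z \<in> T n" for y z
      proof (rule power_less_imp_less_base)
        show "(dist y z)\<^sup>2 < \<epsilon>\<^sup>2"
          using mid[OF that] n unfolding inverse_eq_divide by linarith
      qed (use \<open>\<epsilon> > 0\<close> in simp)
      then show ?thesis by blast
    qed
  qed (use that in blast)
  have "(dist x a)\<^sup>2 \<le> d\<^sup>2"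
  proof (rule field_le_epsilon)
    fix e :: real assume "e > 0"
    then obtain n where "inverse (real (Suc n)) < e" using reals_Archimedean by blast
    then show "(dist x a)\<^sup>2 \<le> d\<^sup>2 + e" using a[of n] by (auto simp: T_def inverse_eq_divide)
  qed
  then have "dist x a \<le> d" using d(1) by (rule power2_le_imp_le)
  then show thesis
    using that[of a] a[of 0] d(2) by (fastforce simp: T_def)
qed

text \<open>With \<open>a\<close> nearest to \<open>x\<close> in \<open>closure V\<close>, the
  residual \<open>x - a\<close> is orthogonal to \<open>V\<close>, hence zero, so \<open>x\<close>
  lies in the closure.\<close>

lemma subspace_dense_if_orthogonal_comp_trivial:
  fixes V :: "'a::{real_inner,complete_space} set"
  assumes V: "subspace V" and triv: "\<And>x. (\<And>v. v \<in> V \<Longrightarrow> inner x v = 0) \<Longrightarrow> x = 0"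
  shows "closure V = UNIV"
proof -
  have "x \<in> closure V" for x
  proof -
    have cl: "convex (closure V)" "closed (closure V)" "closure V \<noteq> {}"
      using V subspace_0[OF V] by (auto simp: convex_closure subspace_imp_convex)
    obtain a where a: "a \<in> closure V" "\<And>y. y \<in> closure V \<Longrightarrow> dist x a \<le> dist x y"
      using closest_point_exists_convex[OF cl] by blast
    have "inner (x - a) v = 0" if v: "v \<in> V" for v
    proof (rule ccontr)
      assume nz: "inner (x - a) v \<noteq> 0"
      \<comment> \<open>This \<open>t\<close> makes \<open>inner (x - a) (t *\<^sub>R v - a)\<close>
        equal to 1, against the obtuse-angle inequality at a nearest point of a convex set.\<close>
      define t where "t = (inner (x - a) a + 1) / inner (x - a) v"
      have "t *\<^sub>R v \<in> closure V"
        using V v closure_subset by (blast intro: subspace_scale)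
      then have "inner (x - a) (t *\<^sub>R v - a) \<le> 0"
        using any_closest_point_dot[OF cl(1,2) a(1)] a(2) by blast
      then show False
        using nz by (simp add: inner_diff_right t_def)
    qed
    then have "x - a = 0" by (rule triv)
    then show ?thesis using a(1) by simp
  qed
  then show ?thesis by auto
qed

section \<open>Operator sums and flipped graphs\<close>

lemma dom_op_sum [simp]: "dom (A +\<^sub>o B) = dom A \<inter> dom B"
  by (auto simp: op_sum_def split: if_splits)

lemma the_op_sum: "h \<in> dom A \<Longrightarrow> h \<in> dom B \<Longrightarrow> the ((A +\<^sub>o B) h) = the (A h) + the (B h)"
  by (simp add: op_sum_def)

lemma op_sum_eq_Some_iff:
  "(A +\<^sub>o B) h = Some z \<longleftrightarrow> (\<exists>x y. A h = Some x \<and> B h = Some y \<and> z = x + y)"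
  by (auto simp: op_sum_def)

lemma linear_operator_op_sum:
  assumes "hilbert_space F sK ipK" and "linear_operator F sH sK A" and "linear_operator F sH sK B"
  shows "linear_operator F sH sK (A +\<^sub>o B)"
proof -
  interpret K: hilbert_space F sK ipK by fact
  show ?thesis
    using assms(2,3) unfolding linear_operator_def dom_op_sum
    by (simp add: the_op_sum K.scale_add_right algebra_simps)
qed

lemma map_eq_iff_graph_eq: "m = m' \<longleftrightarrow> Map.graph m = Map.graph m'"
proof
  assume eq: "Map.graph m = Map.graph m'"
  have "m x = Some y \<longleftrightarrow> m' x = Some y" for x y
    using eq by (auto dest: in_graphD in_graphI)
  then have "m x = m' x" for x
    by (metis option.exhaust)
  then show "m = m'" by (rule ext)
qed simp

lemma inj_flip: "inj (flip :: 'k \<times> 'h::ab_group_add \<Rightarrow> 'h \<times> 'k)"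
  by (auto simp: inj_def flip_def)

lemma mem_flip_graph_iff: "(u, k) \<in> flip ` Map.graph B \<longleftrightarrow> B k = Some (- u :: 'h::ab_group_add)"
  by (force simp: flip_def Map.graph_def)

section \<open>Inner products over real or complex scalars, density and the adjoint\<close>

context hilbert_space
begin

lemma ip_zero_left [simp]: "ip 0 x = 0"
  using ip_add_left[of 0 0 x] by simp

lemma ip_zero_right [simp]: "ip x 0 = 0"
  using ip_commute[of x 0] by simp

lemma ip_add_right: "ip x (y + z) = ip x y + ip x z"
  by (metis ip_commute ip_add_left complex_cnj_add)

lemma ip_minus_left [simp]: "ip (- x) y = - ip x y"
  using ip_add_left[of x "- x" y] by (simp add: eq_neg_iff_add_eq_0 add.commute)

lemma ip_minus_right [simp]: "ip x (- y) = - ip x y"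
  by (metis ip_commute ip_minus_left complex_cnj_minus)

lemma ip_diff_left: "ip (x - y) z = ip x z - ip y z"
  using ip_add_left[of x "- y" z] by simp

lemma ip_self_eq_0_iff: "ip x x = 0 \<longleftrightarrow> x = 0"
  by (metis Re_ip inner_eq_zero_iff ip_zero_left zero_complex.sel(1))

text \<open>The vectors orthogonal to \<open>x - y\<close> form a closed set containing
  \<open>D\<close>, hence contain \<open>x - y\<close> itself. Real parts suffice for this. It gives
  uniqueness of the value of an adjoint.\<close>

lemma eq_if_ip_eq_on_dense:
  assumes D: "closure D = UNIV" and eq: "\<And>h. h \<in> D \<Longrightarrow> ip h x = ip h y"
  shows "x = y"
proof -
  have "closed {h. inner h (x - y) = 0}"
    by (intro closed_Collect_eq continuous_intros)
  moreover have "D \<subseteq> {h. inner h (x - y) = 0}"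
    using eq by (auto simp: inner_diff_right) (metis Re_ip)
  ultimately have "closure D \<subseteq> {h. inner h (x - y) = 0}" by (simp add: closure_minimal)
  then have "inner (x - y) (x - y) = 0" using D by blast
  then show ?thesis by simp
qed

text \<open>Passes from real orthogonality, which the density criterion uses, to orthogonality for
  \<open>ip\<close>. Over the reals \<open>ip v x\<close> is its own real part; over the complex
  numbers its imaginary part is minus the real part of \<open>ip (scale \<i> v) x\<close>, and
  \<open>scale \<i> v\<close> is again in \<open>V\<close>.\<close>

lemma ip_eq_0_if_inner_eq_0:
  assumes V: "\<And>a v. a \<in> F \<Longrightarrow> v \<in> V \<Longrightarrow> scale a v \<in> V"
    and orth: "\<And>v. v \<in> V \<Longrightarrow> inner x v = 0" and v: "v \<in> V"
  shows "ip v x = 0"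
proof -
  have re: "Re (ip w x) = 0" if "w \<in> V" for w
    using orth[OF that] by (simp add: Re_ip inner_commute)
  consider "F = \<real>" | "F = UNIV" using scalars by blast
  then show ?thesis
  proof cases
    case 1
    then show ?thesis
      using re[OF v] ip_in_scalars[of v x] by (auto simp: complex_is_Real_iff complex_eq_iff)
  next
    case 2
    then have "Re (ip (scale \<i> v) x) = 0" using V v re by blast
    then show ?thesis using 2 re[OF v] by (simp add: ip_scale_left complex_eq_iff)
  qed
qed

text \<open>\<open>F\<close> contains the real scalars, so \<open>dom A\<close> is a real subspace
  and the criterion for the real inner product applies.\<close>

lemma densely_definedI:
  assumes A: "linear_operator F scale sK A"
    and triv: "\<And>x. (\<And>h. h \<in> dom A \<Longrightarrow> ip h x = 0) \<Longrightarrow> x = 0"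
  shows "densely_defined A"
  unfolding densely_defined_def
proof (rule subspace_dense_if_orthogonal_comp_trivial)
  have scale: "scale a h \<in> dom A" if "a \<in> F" "h \<in> dom A" for a h
    using A that by (auto simp: linear_operator_def)
  have "of_real r \<in> F" for r :: real
    using scalars by auto
  then have "r *\<^sub>R h \<in> dom A" if "h \<in> dom A" for r h
    using scale[of "of_real r" h] that by (simp add: scale_of_real)
  moreover have "0 \<in> dom A" "\<forall>x\<in>dom A. \<forall>y\<in>dom A. x + y \<in> dom A"
    using A unfolding linear_operator_def by blast+
  ultimately show "subspace (dom A)"
    by (simp add: subspace_def)
  show "x = 0" if "\<And>v. v \<in> dom A \<Longrightarrow> inner x v = 0" for x
    by (rule triv, rule ip_eq_0_if_inner_eq_0[OF scale that])
qed

text \<open>Density makes the representing vector unique, so the definite description in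
  \<open>adjoint_op\<close> can be traded for its defining condition.\<close>

lemma adjoint_op_eq_Some_iff:
  assumes "densely_defined A"
  shows "adjoint_op ip ipK A k = Some z \<longleftrightarrow> (\<forall>h\<in>dom A. ipK (the (A h)) k = ip h z)"
proof -
  have uniq: "x = y" if "\<forall>h\<in>dom A. ipK (the (A h)) k = ip h x" "\<forall>h\<in>dom A. ipK (the (A h)) k = ip h y" for x y
    using assms that by (intro eq_if_ip_eq_on_dense[of "dom A"]) (auto simp: densely_defined_def)
  have "(THE z. \<forall>h\<in>dom A. ipK (the (A h)) k = ip h z) = z" if "\<forall>h\<in>dom A. ipK (the (A h)) k = ip h z" for z
    using that uniq by (intro the_equality) blast+
  then show ?thesis
    unfolding adjoint_op_def by (metis (mono_tags, lifting) option.distinct(1) option.inject)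
qed

end

section \<open>Orthogonal complements of graphs in the product space\<close>

locale hilbert_space_pair =
  H: hilbert_space F sH ipH + K: hilbert_space F sK ipK
  for F :: "complex set"
    and sH :: "complex \<Rightarrow> 'h::{real_inner,complete_space} \<Rightarrow> 'h"
    and ipH :: "'h \<Rightarrow> 'h \<Rightarrow> complex"
    and sK :: "complex \<Rightarrow> 'k::{real_inner,complete_space} \<Rightarrow> 'k"
    and ipK :: "'k \<Rightarrow> 'k \<Rightarrow> complex"
begin

sublocale HK: hilbert_space F "prod_scale sH sK" "prod_ip ipH ipK"
  by (rule hilbert_space_prod) unfold_locales

text \<open>\<open>A\<close> is arbitrary here, so this applies to \<open>R +\<^sub>o S\<close>
  before its density is known. The right-hand side is the defining condition of the adjoint at
  \<open>k\<close> for the value \<open>- u\<close>.\<close>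

lemma mem_orth_compl_graph_iff:
  "(u, k) \<in> orth_compl (prod_ip ipH ipK) (Map.graph A) \<longleftrightarrow>
    (\<forall>h\<in>dom A. ipK (the (A h)) k = ipH h (- u))"
proof -
  have "ipH u h + ipK k (the (A h)) = 0 \<longleftrightarrow> ipK (the (A h)) k = ipH h (- u)" for h
  proof -
    \<comment> \<open>Conjugation swaps the arguments into the order used by
      \<open>adjoint_op\<close> and preserves vanishing.\<close>
    have "ipH u h + ipK k (the (A h)) = cnj (ipH h u + ipK (the (A h)) k)"
      by (metis H.ip_commute K.ip_commute complex_cnj_add)
    then have "ipH u h + ipK k (the (A h)) = 0 \<longleftrightarrow> ipH h u + ipK (the (A h)) k = 0"
      by (simp only: complex_cnj_zero_iff)
    then show ?thesis by (simp add: eq_neg_iff_add_eq_0 add.commute)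
  qed
  then show ?thesis
    by (simp add: orth_compl_def prod_ip_def graph_eq_to_snd_dom)
qed

lemma orth_compl_graph_eq_flip_adjoint:
  assumes "densely_defined A"
  shows "orth_compl (prod_ip ipH ipK) (Map.graph A) = flip ` Map.graph (adjoint_op ipH ipK A)"
proof (rule set_eqI)
  show "p \<in> orth_compl (prod_ip ipH ipK) (Map.graph A) \<longleftrightarrow> p \<in> flip ` Map.graph (adjoint_op ipH ipK A)" for p
    by (cases p)
      (simp only: mem_flip_graph_iff H.adjoint_op_eq_Some_iff[OF assms] mem_orth_compl_graph_iff)
qed

text \<open>On the common domain of \<open>R\<close> and \<open>S\<close> the defining equations of
  the two adjoints add up. Density of each summand is enough; the sum may fail to be densely
  defined.\<close>

lemma flip_adjoint_sum_subset_orth_compl: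
  assumes "densely_defined R" and "densely_defined S"
  shows "flip ` Map.graph (adjoint_op ipH ipK R +\<^sub>o adjoint_op ipH ipK S)
    \<subseteq> orth_compl (prod_ip ipH ipK) (Map.graph (R +\<^sub>o S))"
proof -
  have "(- (x + y), k) \<in> orth_compl (prod_ip ipH ipK) (Map.graph (R +\<^sub>o S))"
    if "adjoint_op ipH ipK R k = Some x" "adjoint_op ipH ipK S k = Some y" for k x y
    using that
    unfolding mem_orth_compl_graph_iff H.adjoint_op_eq_Some_iff[OF assms(1)]
      H.adjoint_op_eq_Some_iff[OF assms(2)]
    by (simp add: the_op_sum K.ip_add_left H.ip_add_right del: minus_add_distrib)
  then show ?thesis
    by (auto simp: flip_def Map.graph_def op_sum_eq_Some_iff)
qed

section \<open>Equivalence of the three conditions\<close>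

theorem adjoint_sum_iff_orth_compl_graph:
  assumes R: "linear_operator F sH sK R" "densely_defined R"
    and S: "linear_operator F sH sK S" "densely_defined S"
  defines "T \<equiv> R +\<^sub>o S" and "B \<equiv> adjoint_op ipH ipK R +\<^sub>o adjoint_op ipH ipK S"
  shows "densely_defined T \<and> adjoint_op ipH ipK T = B \<longleftrightarrow>
    orth_compl (prod_ip ipH ipK) (Map.graph T) = flip ` Map.graph B" (is "?i \<longleftrightarrow> ?ii")
    and "orth_compl (prod_ip ipH ipK) (Map.graph T) = flip ` Map.graph B \<longleftrightarrow>
    orth_compl (prod_ip ipH ipK) (Map.graph T) \<subseteq> ran (M_op T B)" (is "?ii \<longleftrightarrow> ?iii")
proof -
  have T: "linear_operator F sH sK T"
    unfolding T_def using R(1) S(1) by (intro linear_operator_op_sum[OF K.hilbert_space_axioms])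
  then have T0: "0 \<in> dom T" "the (T 0) = 0"
  proof -
    show 0: "0 \<in> dom T" using T by (simp add: linear_operator_def)
    then have "the (T (0 + 0)) = the (T 0) + the (T 0)"
      using T unfolding linear_operator_def by blast
    then show "the (T 0) = 0" by simp
  qed
  \<comment> \<open>Both adjoints vanish at 0, so a point \<open>(u, 0)\<close> of the flipped graph
    of \<open>B\<close> must have \<open>u = 0\<close>; density of \<open>dom T\<close> will rest on
    this.\<close>
  have B0: "B 0 = Some 0"
    unfolding B_def op_sum_eq_Some_iff
    by (simp add: H.adjoint_op_eq_Some_iff[OF R(2)] H.adjoint_op_eq_Some_iff[OF S(2)]
        exI[of _ 0])
  have sub: "flip ` Map.graph B \<subseteq> orth_compl (prod_ip ipH ipK) (Map.graph T)"
    unfolding T_def B_def by (rule flip_adjoint_sum_subset_orth_compl[OF R(2) S(2)])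
  show "?i \<longleftrightarrow> ?ii"
  proof
    assume ?i
    then show ?ii using orth_compl_graph_eq_flip_adjoint by blast
  next
    assume ii: ?ii
    have dd: "densely_defined T"
    proof (rule H.densely_definedI[OF T])
      fix u assume "\<And>h. h \<in> dom T \<Longrightarrow> ipH h u = 0"
      then have "(u, 0) \<in> orth_compl (prod_ip ipH ipK) (Map.graph T)"
        by (simp add: mem_orth_compl_graph_iff)
      then show "u = 0" unfolding ii mem_flip_graph_iff using B0 by simp
    qed
    \<comment> \<open>Once \<open>T\<close> is dense, its adjoint and \<open>B\<close> have the same
      flipped graph, and injectivity of \<open>flip\<close> cancels the flip.\<close>
    then have "Map.graph (adjoint_op ipH ipK T) = Map.graph B"
      using ii orth_compl_graph_eq_flip_adjoint inj_flip by (metis inj_image_eq_iff)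
    then show ?i using dd by (simp add: map_eq_iff_graph_eq)
  qed
  show "?ii \<longleftrightarrow> ?iii"
  proof
    assume ii: ?ii
    show ?iii
    proof
      fix p assume "p \<in> orth_compl (prod_ip ipH ipK) (Map.graph T)"
      then obtain u k where p: "p = (u, k)" "B k = Some (- u)"
        unfolding ii by (cases p) (simp add: mem_flip_graph_iff)
      \<comment> \<open>The preimage has first component 0: as \<open>T\<close> vanishes at 0, the
        value is \<open>(- the (B k), k)\<close>, which is \<open>(u, k)\<close>.\<close>
      then have "M_op T B (0, k) = Some p"
        using T0 by (auto simp: M_op_def)
      then show "p \<in> ran (M_op T B)" by (rule ranI)
    qed
  next
    assume iii: ?iii
    have "orth_compl (prod_ip ipH ipK) (Map.graph T) \<subseteq> flip ` Map.graph B"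
    proof
      fix p assume p: "p \<in> orth_compl (prod_ip ipH ipK) (Map.graph T)"
      then obtain h k where hk: "h \<in> dom T" "k \<in> dom B" "p = (h - the (B k), the (T h) + k)"
        using iii by (auto simp: ran_def M_op_def split: if_splits)
      define q where "q = (- the (B k), k)"
      have q: "q \<in> flip ` Map.graph B"
        using hk(2) by (auto simp: q_def mem_flip_graph_iff)
      have "p - q = (h, the (T h))"
        by (simp add: q_def hk(3))
      moreover have "(h, the (T h)) \<in> Map.graph T"
        using hk(1) by (auto simp: graph_eq_to_snd_dom)
      \<comment> \<open>By \<open>sub\<close> the point \<open>q\<close> is also in the orthogonal
        complement, which is closed under differences; being in the graph as well,
        \<open>p - q\<close> is orthogonal to itself.\<close>
      moreover have "p - q \<in> orth_compl (prod_ip ipH ipK) (Map.graph T)"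
        using p q sub by (auto simp: orth_compl_def HK.ip_diff_left)
      ultimately have "prod_ip ipH ipK (p - q) (p - q) = 0"
        by (simp add: orth_compl_def)
      then have "p = q" by (simp add: HK.ip_self_eq_0_iff)
      then show "p \<in> flip ` Map.graph B" using q by simp
    qed
    then show ?ii using sub by blast
  qed
qed

end

theorem theorem4p1:
  fixes F :: "complex set"
    and sH :: "complex \<Rightarrow> 'h::{real_inner,complete_space} \<Rightarrow> 'h"
    and sK :: "complex \<Rightarrow> 'k::{real_inner,complete_space} \<Rightarrow> 'k"
    and ipH :: "'h \<Rightarrow> 'h \<Rightarrow> complex"
    and ipK :: "'k \<Rightarrow> 'k \<Rightarrow> complex"
    and R S :: "'h \<rightharpoonup> 'k"
  assumes "hilbert_space F sH ipH"
    and "hilbert_space F sK ipK"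
    and "linear_operator F sH sK R" and "densely_defined R"
    and "linear_operator F sH sK S" and "densely_defined S"
  shows "((densely_defined (R +\<^sub>o S) \<and>
           adjoint_op ipH ipK (R +\<^sub>o S) = adjoint_op ipH ipK R +\<^sub>o adjoint_op ipH ipK S)
          \<longleftrightarrow>
          orth_compl (prod_ip ipH ipK) (Map.graph (R +\<^sub>o S)) =
            flip ` Map.graph (adjoint_op ipH ipK R +\<^sub>o adjoint_op ipH ipK S))
         \<and>
         (orth_compl (prod_ip ipH ipK) (Map.graph (R +\<^sub>o S)) =
            flip ` Map.graph (adjoint_op ipH ipK R +\<^sub>o adjoint_op ipH ipK S)
          \<longleftrightarrow>
          orth_compl (prod_ip ipH ipK) (Map.graph (R +\<^sub>o S)) \<subseteq>
            ran (M_op (R +\<^sub>o S) (adjoint_op ipH ipK R +\<^sub>o adjoint_op ipH ipK S)))"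
proof -
  interpret hilbert_space_pair F sH ipH sK ipK
    using assms(1,2) by (rule hilbert_space_pair.intro)
  show ?thesis
    using adjoint_sum_iff_orth_compl_graph[OF assms(3-6)] by blast
qed

end
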